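(* Let $\mathbf{X}$ be a random vector in $\mathbb{R}^d$ ($d\ge 1$) with distribution $\mu^X$, and let $g:\mathbb{R}^d\to\mathbb{R}$ be measurable such that the cdf of $g(\mathbf{X})$ is continuous. Let $q\in\mathbb{R}$, let $F=\{\mathbf{x}\in\mathbb{R}^d \mid g(\mathbf{x})>q\}$ and $p=\mu^X(F)$, with $p>0$. Then the number of moves that the one-particle moving algorithm needs to get a realisation of $\mathbf{X}$ in $F$ follows a Poisson law with parameter $\log(1/p)$.
   Context: One-particle moving algorithm (ideal case, where exact conditional sampling is possible): set $q_0=-\infty$; for $m=0,1,2,\dots$, conditionally on the past, sample $\mathbf{X}_{m+1}\sim\mu^X(\,\cdot\mid g>q_m)$ and set $q_{m+1}=g(\mathbf{X}_{m+1})$. Thus $\mathbf{X}_1\sim\mu^X$ is the initial position of the particle, and each subsequent sampling is a move. The number of moves needed to get a realisation in $F$ does not count the initial sampling, i.e. it equals $\min\{m\ge 1: q_m>q\}-1=\#\{m\ge 1: q_m\le q\}$. *)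

theory Defs
  imports "HOL-Probability.Probability"
begin

text \<open>
  The particle positions are \<open>Xs 1, Xs 2, ...\<close>; \<open>Xs 0\<close> is never used.  The levels are
  extended reals because the initial level is \<open>-\<infinity>\<close>.
\<close>

fun level :: "('x \<Rightarrow> real) \<Rightarrow> (nat \<Rightarrow> 'a \<Rightarrow> 'x) \<Rightarrow> nat \<Rightarrow> 'a \<Rightarrow> ereal" where
  "level g Xs 0 \<omega> = -\<infinity>"
| "level g Xs (Suc m) \<omega> = ereal (g (Xs (Suc m) \<omega>))"

definition past :: "'a measure \<Rightarrow> (nat \<Rightarrow> 'a \<Rightarrow> 'x::topological_space) \<Rightarrow> nat \<Rightarrow> 'a measure" where
  "past M Xs m = sigma (space M) {Xs i -` A \<inter> space M | i A. i \<in> {1..m} \<and> A \<in> sets borel}"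

text \<open>
  \<open>sampling\<close> says that, given the past, \<open>Xs (m + 1)\<close> has law \<open>\<mu>(\<cdot> | g > q\<^sub>m)\<close>.  The right-hand
  side is, for each \<open>\<omega>\<close>, the elementary conditional probability; \<open>cond_prob\<close> is \<open>0\<close> if the
  conditioning event is null.  For \<open>m = 0\<close> the past is trivial and the condition
  reads \<open>P(Xs 1 \<in> A) = \<mu> A\<close>.
\<close>

locale one_particle_process = prob_space M
  for M :: "'a measure" +
  fixes \<mu> :: "'x::topological_space measure"
    and g :: "'x \<Rightarrow> real"
    and Xs :: "nat \<Rightarrow> 'a \<Rightarrow> 'x"
  assumes random_variable_Xs: "m \<ge> 1 \<Longrightarrow> random_variable borel (Xs m)"
    and sampling: "A \<in> sets borel \<Longrightarrow>
      AE \<omega> in M. real_cond_exp M (past M Xs m) (\<lambda>\<omega>'. indicator A (Xs (Suc m) \<omega>')) \<omega>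
        = \<P>(x in \<mu>. x \<in> A \<bar> level g Xs m \<omega> < ereal (g x))"

text \<open>
  \<open>\<infinity>\<close> if the level \<open>q\<close> is never exceeded: the infimum of the empty set is \<open>\<infinity>\<close>, and
  \<open>\<infinity> - 1 = \<infinity>\<close> in \<open>enat\<close>.
\<close>

definition number_of_moves :: "('x \<Rightarrow> real) \<Rightarrow> (nat \<Rightarrow> 'a \<Rightarrow> 'x) \<Rightarrow> real \<Rightarrow> 'a \<Rightarrow> enat" where
  "number_of_moves g Xs q \<omega> = (INF m \<in> {m. m \<ge> 1 \<and> level g Xs m \<omega> > ereal q}. enat m) - 1"

text \<open>
  \<^const>\<open>poisson_pmf\<close> is unspecified at rate \<open>0\<close>, where the Poisson law is the Dirac mass at \<open>0\<close>.
\<close>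

definition poisson_law :: "real \<Rightarrow> nat pmf" where
  "poisson_law r = (if r = 0 then return_pmf 0 else poisson_pmf r)"

lemma pmf_poisson_law:
  assumes "r \<ge> 0"
  shows "pmf (poisson_law r) k = r ^ k / fact k * exp (- r)"
  using assms by (cases k) (auto simp: poisson_law_def)

end

(*
  Let S y = \<mu> {g > y}.  Since the cdf of g(X) is continuous, S(g(X)) is uniform on [0,1], so
  given the past S(q_{m+1}) is uniform on [0, S(q_m)].  Put
  w_j(u) = (p/u) ln(u/p)^j / j! and e(k,j) = E[w_j(S(q_k)); q_1, ..., q_k \<le> q].
  The antiderivative of w_j is u w_{j+1}(u), so averaging w_j over [p, s] with respect to the
  uniform law on [0, s] gives w_{j+1}(s), that is e(k+1,j) = e(k,j+1).  The probability of
  exactly k moves is e(k,0), because p/S(q_k) is the chance to jump from q_k into F.  Hence it equals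
  e(0,k) = w_k(1) = p ln(1/p)^k / k!.
*)

theory Submission
  imports Defs
begin

section \<open>Uniform law of the upper tail of a continuous distribution\<close>

text \<open>The probability integral transform, for the upper tail. \<open>?T\<close> is antitone
  and, by continuity, takes each value u in (0,1) at some t; the half-line \<open>{t<..}\<close>
  then has mass u and can be compared with the sublevel sets of \<open>?T\<close>.\<close>

lemma (in real_distribution) distr_tail_uniform:
  assumes cont: "continuous_on UNIV (cdf M)"
  shows "distr M borel (\<lambda>t. 1 - cdf M t) = uniform_measure lborel {0..1}"
proof (rule cdf_unique)
  let ?T = "\<lambda>t. 1 - cdf M t"
  have [measurable]: "?T \<in> borel_measurable borel"
    using cont by (intro borel_measurable_continuous_onI continuous_intros)
  show "real_distribution (distr M borel ?T)"
    by (rule real_distribution_distr) simp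
  interpret U: prob_space "uniform_measure lborel {0..1::real}"
    by (rule prob_space_uniform_measure) auto
  show "real_distribution (uniform_measure lborel {0..1::real})"
    by (intro real_distribution.intro U.prob_space_axioms real_distribution_axioms.intro) simp
  have tail: "prob {t<..} = ?T t" for t
    using prob_compl[of "{..t}"] by (simp add: cdf_def Compl_eq_Diff_UNIV[symmetric] Compl_atMost)
  have antimono_T: "?T t \<le> ?T s" if "s \<le> t" for s t
    using cdf_nondecreasing[OF that] by simp
  \<comment> \<open>Intermediate values between the limits of the cdf at both ends. The limits
    themselves need not be attained, so only interior u are covered.\<close>
  have level_set: "\<exists>t. ?T t = u" if u: "0 < u" "u < 1" for u
  proof -
    have "\<forall>\<^sub>F t in at_top. 1 - u < cdf M t"
      using cdf_lim_at_top_prob u by (auto elim!: order_tendstoD)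
    then obtain b where b: "1 - u < cdf M b"
      by (auto simp: eventually_at_top_linorder)
    have "\<forall>\<^sub>F t in at_bot. cdf M t < 1 - u"
      using cdf_lim_at_bot u by (auto elim!: order_tendstoD)
    then obtain a where a: "cdf M a < 1 - u"
      by (auto simp: eventually_at_bot_linorder)
    have "a \<le> b"
      using a b cdf_nondecreasing[of b a] by linarith
    then obtain t where "cdf M t = 1 - u"
      using IVT'[of "cdf M" a "1 - u" b] a b cont continuous_on_subset by (metis less_imp_le top_greatest)
    then show ?thesis by (intro exI[of _ t]) simp
  qed
  txt \<open>Continuity of the law of \<open>?T\<close> is not known yet, so the bounds are obtained from
    opposite sides for \<open>\<le>\<close> and \<open><\<close>.\<close>
  have lower: "u \<le> prob {t. ?T t \<le> u}" if u: "0 < u" "u < 1" for u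
  proof -
    obtain t where t: "?T t = u" using level_set[OF u] by blast
    have "{t<..} \<subseteq> {s. ?T s \<le> u}"
      using antimono_T t by (auto simp: less_imp_le)
    then have "prob {t<..} \<le> prob {s. ?T s \<le> u}"
      by (intro finite_measure_mono) auto
    then show ?thesis using tail t by simp
  qed
  have upper: "prob {t. ?T t < u} \<le> u" if u: "0 < u" "u < 1" for u
  proof -
    obtain t where t: "?T t = u" using level_set[OF u] by blast
    have "{s. ?T s < u} \<subseteq> {t<..}"
    proof
      fix s assume "s \<in> {s. ?T s < u}"
      then show "s \<in> {t<..}" using antimono_T[of s t] t by (cases "s \<le> t") auto
    qed
    then have "prob {s. ?T s < u} \<le> prob {t<..}"
      by (intro finite_measure_mono) auto
    then show ?thesis using tail t by simp
  qed
  \<comment> \<open>Letting v decrease to u turns the bound for \<open><\<close> into one for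
    \<open>\<le>\<close>. It also reaches u = 0, where it excludes an atom.\<close>
  have upper': "prob {t. ?T t \<le> u} \<le> u" if u: "0 \<le> u" "u < 1" for u
  proof (rule dense_ge_bounded[OF u(2)])
    fix v assume v: "u < v" "v < 1"
    have "prob {t. ?T t \<le> u} \<le> prob {t. ?T t < v}"
      using v by (intro finite_measure_mono) auto
    with upper[of v] u v show "prob {t. ?T t \<le> u} \<le> v" by simp
  qed
  show "cdf (distr M borel ?T) = cdf (uniform_measure lborel {0..1})"
  proof
    fix u :: real
    have L: "cdf (distr M borel ?T) u = prob {t. ?T t \<le> u}"
      by (simp add: cdf_def[of "distr M borel ?T"] measure_distr vimage_def)
    have R: "cdf (uniform_measure lborel {0..1}) u = measure lborel ({0..1} \<inter> {..u})"
      by (simp add: cdf_def measure_uniform_measure)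
    consider "u < 0" | "u = 0" | "0 < u" "u < 1" | "1 \<le> u" by linarith
    then show "cdf (distr M borel ?T) u = cdf (uniform_measure lborel {0..1}) u"
    proof cases
      case 1
      then have "{t. ?T t \<le> u} = {}" "{0..1} \<inter> {..u} = {}"
        using cdf_bounded_prob by (auto simp: not_le intro: order.strict_trans2)
      then show ?thesis unfolding L R by simp
    next
      case 2
      then have "{0..1} \<inter> {..u} = {0}" by auto
      moreover have "prob {t. ?T t \<le> u} = 0"
        using upper'[of u] 2 measure_nonneg[of M "{t. ?T t \<le> u}"] by linarith
      ultimately show ?thesis unfolding L R by simp
    next
      case 3
      then have "{0..1} \<inter> {..u} = {0..u}" by auto
      with 3 lower[of u] upper'[of u] show ?thesis unfolding L R by simp
    next
      case 4
      then have "{t. ?T t \<le> u} = space M" "{0..1} \<inter> {..u} = {0..1}"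
        using cdf_nonneg by (auto intro: order.trans[rotated])
      then show ?thesis unfolding L R by (simp add: prob_space del: space_eq_univ)
    qed
  qed
qed

section \<open>Tail function of the score and the substitution u = \<open>tail (g x)\<close>\<close>

locale continuous_score = prob_space \<mu>
  for \<mu> :: "'x::topological_space measure" +
  fixes g :: "'x \<Rightarrow> real"
  assumes sets_eq_borel [measurable_cong]: "sets \<mu> = sets borel"
    and score_measurable [measurable]: "g \<in> borel_measurable borel"
    and continuous_cdf: "continuous_on UNIV (cdf (distr \<mu> borel g))"
begin

lemma space_eq_UNIV [simp]: "space \<mu> = UNIV"
  using sets_eq_imp_space_eq[OF sets_eq_borel] by simp

definition tail :: "ereal \<Rightarrow> real" where
  "tail y = prob {x. y < ereal (g x)}"

lemma tail_MInfty: "tail (- \<infinity>) = 1"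
  using prob_space by (simp add: tail_def)

lemma tail_nonneg: "0 \<le> tail y"
  by (simp add: tail_def)

lemma tail_le_1: "tail y \<le> 1"
  by (simp add: tail_def)

lemma tail_antimono: "y \<le> z \<Longrightarrow> tail z \<le> tail y"
  unfolding tail_def by (intro finite_measure_mono) (auto intro: order.strict_trans1)

lemma tail_measurable [measurable]: "tail \<in> borel_measurable borel"
proof -
  \<comment> \<open>The indicator is jointly measurable in x and y, so its integral over x is
    measurable in y.\<close>
  have "tail y = enn2real (\<integral>\<^sup>+x. indicator {x. y < ereal (g x)} x \<partial>\<mu>)" for y
    by (simp add: tail_def measure_def)
  then have "tail = (\<lambda>y. enn2real (\<integral>\<^sup>+x. indicator {x. y < ereal (g x)} x \<partial>\<mu>))"
    by (rule ext)
  then show ?thesis by simp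
qed

lemma tail_ereal: "tail (ereal t) = 1 - cdf (distr \<mu> borel g) t"
proof -
  have "{x. t < g x} = space \<mu> - {x. g x \<le> t}"
    by auto
  then show ?thesis
    using prob_compl[of "{x. g x \<le> t}"]
    by (simp add: tail_def cdf_def measure_distr vimage_def del: space_eq_UNIV)
qed

lemma distr_tail_score: "distr \<mu> borel (\<lambda>x. tail (g x)) = uniform_measure lborel {0..1}"
proof -
  interpret D: real_distribution "distr \<mu> borel g"
    by simp
  have "distr \<mu> borel (\<lambda>x. tail (g x)) = distr (distr \<mu> borel g) borel (\<lambda>t. tail (ereal t))"
    by (subst distr_distr) (auto simp: comp_def)
  also have "\<dots> = uniform_measure lborel {0..1}"
    unfolding tail_ereal by (rule D.distr_tail_uniform[OF continuous_cdf])
  finally show ?thesis .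
qed

text \<open>The uniform law has no atoms. This makes flat stretches of \<open>tail\<close> and the
  choice between strict and weak inequalities harmless.\<close>

lemma AE_tail_score_neq: "AE x in \<mu>. tail (g x) \<noteq> u"
proof -
  have "emeasure (uniform_measure lborel {0..1}) {u} = 0"
    by (subst emeasure_uniform_measure) (auto simp: Int_insert_right)
  then have "emeasure \<mu> {x. tail (g x) = u} = 0"
    unfolding distr_tail_score[symmetric] by (subst (asm) emeasure_distr) (auto simp: vimage_def)
  then show ?thesis by (intro AE_I[where N = "{x. tail (g x) = u}"]) auto
qed

text \<open>Since \<open>tail\<close> is antitone, the window y < g x \<le> q corresponds to the
  interval from \<open>tail q\<close> to \<open>tail y\<close>, up to the null events that
  \<open>tail (g x)\<close> equals an endpoint. The new variable is uniform on [0,1].\<close>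

lemma nn_integral_tail_score:
  assumes [measurable]: "f \<in> borel_measurable borel"
  shows "(\<integral>\<^sup>+x. f (tail (g x)) * indicator {x. y < ereal (g x) \<and> g x \<le> q} x \<partial>\<mu>)
    = (\<integral>\<^sup>+u. f u * indicator {tail q..tail y} u \<partial>lborel)"
proof -
  have "AE x in \<mu>. (y < ereal (g x) \<and> g x \<le> q) = (tail (g x) \<in> {tail q..tail y})"
    using AE_tail_score_neq[of "tail q"] AE_tail_score_neq[of "tail y"]
  proof eventually_elim
    fix x assume "tail (g x) \<noteq> tail q" "tail (g x) \<noteq> tail y"
    then show "(y < ereal (g x) \<and> g x \<le> q) = (tail (g x) \<in> {tail q..tail y})"
      using tail_antimono[of y "g x"] tail_antimono[of "g x" y]
        tail_antimono[of q "g x"] tail_antimono[of "g x" q]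
        linorder_le_less_linear[of "ereal (g x)" y] linorder_le_less_linear[of "g x" q]
      by auto
  qed
  then have "(\<integral>\<^sup>+x. f (tail (g x)) * indicator {x. y < ereal (g x) \<and> g x \<le> q} x \<partial>\<mu>)
      = (\<integral>\<^sup>+x. f (tail (g x)) * indicator {tail q..tail y} (tail (g x)) \<partial>\<mu>)"
    by (intro nn_integral_cong_AE) (auto simp: indicator_def)
  also have "\<dots> = (\<integral>\<^sup>+u. f u * indicator {tail q..tail y} u \<partial>distr \<mu> borel (\<lambda>x. tail (g x)))"
    by (subst nn_integral_distr) auto
  also have "\<dots> = (\<integral>\<^sup>+u. f u * indicator {tail q..tail y} u * indicator {0..1} u \<partial>lborel)"
    unfolding distr_tail_score
    by (subst nn_integral_uniform_measure) (auto simp: divide_ennreal_def)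
  also have "\<dots> = (\<integral>\<^sup>+u. f u * indicator {tail q..tail y} u \<partial>lborel)"
    using tail_nonneg[of q] tail_le_1[of y]
    by (intro nn_integral_cong) (auto simp: indicator_def)
  finally show ?thesis .
qed

end

section \<open>Logarithmic weights and their integrals\<close>

text \<open>For 0 < p \<le> u this is the Poisson mass at j for the rate ln (u / p), because exp (-
  ln (u / p)) = p / u.\<close>

definition log_weight :: "real \<Rightarrow> nat \<Rightarrow> real \<Rightarrow> real" where
  "log_weight p j u = p / u * (ln (u / p) ^ j / fact j)"

lemma log_weight_measurable [measurable]: "log_weight p j \<in> borel_measurable borel"
  unfolding log_weight_def[abs_def] by measurable

lemma log_weight_nonneg: "0 < p \<Longrightarrow> p \<le> u \<Longrightarrow> 0 \<le> log_weight p j u"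
  by (auto simp: log_weight_def intro!: mult_nonneg_nonneg divide_nonneg_nonneg zero_le_power)

lemma nn_integral_log_weight:
  assumes p: "0 < p" and s: "p \<le> s"
  shows "(\<integral>\<^sup>+u. ennreal (log_weight p j u) * indicator {p..s} u \<partial>lborel)
    = ennreal (s * log_weight p (Suc j) s)"
proof -
  \<comment> \<open>This is \<open>u * log_weight p (Suc j) u\<close> with u cancelled. It vanishes
    at u = p, since ln 1 = 0 and the exponent is positive.\<close>
  let ?F = "\<lambda>u. p * ln (u / p) ^ Suc j / fact (Suc j)"
  have "(\<integral>\<^sup>+u. ennreal (log_weight p j u) * indicator {p..s} u \<partial>lborel) = ennreal (?F s - ?F p)"
  proof (rule nn_integral_FTC_Icc)
    fix u assume "u \<in> {p..s}"
    then have u: "p \<le> u" by simp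
    have "DERIV (\<lambda>u. p * ln (u / p) ^ Suc j / fact (Suc j)) u :>
        p * (real (Suc j) * ln (u / p) ^ j * (1 / u)) / fact (Suc j)"
      using p u by (auto intro!: derivative_eq_intros simp del: power_Suc fact_Suc)
    also have "p * (real (Suc j) * ln (u / p) ^ j * (1 / u)) / fact (Suc j) = log_weight p j u"
      by (simp add: log_weight_def divide_simps)
    finally show "DERIV ?F u :> log_weight p j u" .
    show "0 \<le> log_weight p j u"
      using p u by (intro log_weight_nonneg)
  qed (use s in auto)
  also have "?F s - ?F p = s * log_weight p (Suc j) s"
    using p s by (simp add: log_weight_def)
  finally show ?thesis .
qed

section \<open>The number of moves as a first passage index\<close>

lemma number_of_moves_eq_enat_iff:
  "number_of_moves g Xs q \<omega> = enat k
    \<longleftrightarrow> (\<forall>i\<in>{1..k}. g (Xs i \<omega>) \<le> q) \<and> q < g (Xs (Suc k) \<omega>)"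
proof -
  have level: "ereal q < level g Xs m \<omega> \<longleftrightarrow> q < g (Xs m \<omega>)" if "1 \<le> m" for m
    using that by (cases m) auto
  define S where "S = {m. 1 \<le> m \<and> q < g (Xs m \<omega>)}"
  have moves: "number_of_moves g Xs q \<omega> = (INF m\<in>S. enat m) - 1"
    unfolding number_of_moves_def S_def using level by (intro arg_cong2[where f = "(-)"] INF_cong) auto
  have iff: "(\<forall>i\<in>{1..k}. g (Xs i \<omega>) \<le> q) \<and> q < g (Xs (Suc k) \<omega>)
      \<longleftrightarrow> Suc k \<in> S \<and> (\<forall>m\<in>S. Suc k \<le> m)"
    by (auto simp: S_def not_less_eq_eq[symmetric] not_less[symmetric])
  show ?thesis
  proof (cases "S = {}")
    \<comment> \<open>The infimum is infinite here and stays so after subtracting 1, hence differs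
      from every \<open>enat k\<close>; the right-hand side fails as well.\<close>
    case True
    then show ?thesis
      unfolding iff moves by (simp add: top_enat_def one_enat_def)
  next
    case False
    define l where "l = (LEAST m. m \<in> S)"
    have l: "l \<in> S" "\<And>m. m \<in> S \<Longrightarrow> l \<le> m"
      using False by (auto simp: l_def intro: LeastI Least_le)
    have "(INF m\<in>S. enat m) = enat l"
      using l by (intro antisym INF_lower INF_greatest) auto
    \<comment> \<open>Subtraction is truncated, so l - 1 = k gives l = k + 1 only because l = 0 is
      excluded.\<close>
    moreover have "1 \<le> l" using l by (simp add: S_def)
    moreover have "Suc k \<in> S \<and> (\<forall>m\<in>S. Suc k \<le> m) \<longleftrightarrow> l = Suc k"
      using l by (auto intro: antisym)
    ultimately show ?thesis
      unfolding iff moves by (auto simp: one_enat_def)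
  qed
qed

section \<open>The sampling rule integrated over events of the past\<close>

locale continuous_one_particle_process =
  one_particle_process M \<mu> g Xs + \<mu>: continuous_score \<mu> g
  for M :: "'a measure" and \<mu> :: "'x::topological_space measure" and g Xs
begin

lemma Xs_measurable [measurable]: "Xs (Suc m) \<in> borel_measurable M"
  by (rule random_variable_Xs) simp

lemma level_measurable [measurable]: "level g Xs m \<in> borel_measurable M"
proof (cases m)
  case 0
  then have "level g Xs m = (\<lambda>_. - \<infinity>)" by auto
  then show ?thesis by simp
next
  case (Suc n)
  then have "level g Xs m = (\<lambda>\<omega>. ereal (g (Xs (Suc n) \<omega>)))" by auto
  then show ?thesis by simp
qed

lemma subalgebra_past: "subalgebra M (past M Xs m)"
proof -
  have "{Xs i -` A \<inter> space M | i A. i \<in> {1..m} \<and> A \<in> sets borel} \<subseteq> sets M"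
    by (auto intro!: measurable_sets[OF random_variable_Xs])
  moreover from this have "{Xs i -` A \<inter> space M | i A. i \<in> {1..m} \<and> A \<in> sets borel} \<subseteq> Pow (space M)"
    by blast
  ultimately show ?thesis
    unfolding past_def subalgebra_def
    by (simp add: space_measure_of sets_measure_of sets.sigma_sets_subset)
qed

lemma sampling_event:
  assumes B: "B \<in> sets M" and A: "A \<in> sets borel"
  shows "{\<omega> \<in> B. Xs (Suc m) \<omega> \<in> A} \<in> sets M"
proof -
  have "{\<omega> \<in> B. Xs (Suc m) \<omega> \<in> A} = B \<inter> (Xs (Suc m) -` A \<inter> space M)"
    using sets.sets_into_space[OF B] by auto
  with A B show ?thesis by auto
qed

text \<open>
  Where the conditioning event is null, the integrand is \<open>0 * \<infinity> = 0\<close>, in agreement with the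
  value \<open>0\<close> of \<open>cond_prob\<close>.
\<close>

lemma sampling_emeasure:
  assumes B: "B \<in> sets (past M Xs m)" and A [measurable]: "A \<in> sets borel"
  shows "emeasure M {\<omega> \<in> B. Xs (Suc m) \<omega> \<in> A}
    = (\<integral>\<^sup>+\<omega>. emeasure \<mu> {x \<in> A. level g Xs m \<omega> < ereal (g x)} * inverse (ennreal (\<mu>.tail (level g Xs m \<omega>)))
        * indicator B \<omega> \<partial>M)"
proof -
  interpret finite_measure_subalgebra M "past M Xs m"
    by standard (rule subalgebra_past)
  have BM [measurable]: "B \<in> sets M"
    using B subalgebra_past by (auto simp: subalgebra_def)
  note [measurable] = sampling_event[OF BM A]
  let ?c = "\<lambda>\<omega>. \<P>(x in \<mu>. x \<in> A \<bar> level g Xs m \<omega> < ereal (g x))"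
  have c: "ennreal (?c \<omega>) = emeasure \<mu> {x \<in> A. level g Xs m \<omega> < ereal (g x)}
      * inverse (ennreal (\<mu>.tail (level g Xs m \<omega>)))" for \<omega>
  proof (cases "\<mu>.tail (level g Xs m \<omega>) = 0")
    case True
    have "\<mu>.prob {x \<in> A. level g Xs m \<omega> < ereal (g x)} \<le> \<mu>.tail (level g Xs m \<omega>)"
      unfolding \<mu>.tail_def by (intro \<mu>.finite_measure_mono) auto
    with True have "emeasure \<mu> {x \<in> A. level g Xs m \<omega> < ereal (g x)} = 0"
      by (simp add: \<mu>.emeasure_eq_measure measure_le_0_iff)
    with True show ?thesis by (simp add: cond_prob_def \<mu>.tail_def)
  next
    case False
    then have "0 < \<mu>.tail (level g Xs m \<omega>)"
      using \<mu>.tail_nonneg[of "level g Xs m \<omega>"] by simp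
    then show ?thesis
      by (simp add: \<mu>.emeasure_eq_measure cond_prob_def \<mu>.tail_def divide_ennreal flip: divide_ennreal_def)
  qed
  have c_AE: "AE \<omega> in M. real_cond_exp M (past M Xs m) (\<lambda>\<omega>'. indicator A (Xs (Suc m) \<omega>')) \<omega> = ?c \<omega>"
    by (rule sampling[OF A])
  have int: "integrable M (\<lambda>\<omega>. indicator A (Xs (Suc m) \<omega>) :: real)"
    by (intro integrable_const_bound[where B = 1]) auto
  have "ennreal (prob {\<omega> \<in> B. Xs (Suc m) \<omega> \<in> A})
      = ennreal (\<integral>\<omega>\<in>B. indicator A (Xs (Suc m) \<omega>) \<partial>M)"
  proof -
    have "(\<integral>\<omega>\<in>B. indicator A (Xs (Suc m) \<omega>) \<partial>M) = (\<integral>\<omega>. indicator {\<omega> \<in> B. Xs (Suc m) \<omega> \<in> A} \<omega> \<partial>M)"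
      unfolding set_lebesgue_integral_def by (intro Bochner_Integration.integral_cong) (auto simp: indicator_def)
    also have "\<dots> = prob {\<omega> \<in> B. Xs (Suc m) \<omega> \<in> A}"
      by (simp add: Int_absorb2 sets.sets_into_space[OF sampling_event[OF BM A]])
    finally show ?thesis by simp
  qed
  \<comment> \<open>The defining property of conditional expectation; it applies because B lies in
    the past.\<close>
  also have "(\<integral>\<omega>\<in>B. indicator A (Xs (Suc m) \<omega>) \<partial>M)
      = (\<integral>\<omega>\<in>B. real_cond_exp M (past M Xs m) (\<lambda>\<omega>'. indicator A (Xs (Suc m) \<omega>')) \<omega> \<partial>M)"
    by (rule real_cond_exp_intA[OF int B])
  also have "ennreal \<dots> = (\<integral>\<^sup>+\<omega>. ennreal (indicator B \<omega> * real_cond_exp M (past M Xs m) (\<lambda>\<omega>'. indicator A (Xs (Suc m) \<omega>')) \<omega>) \<partial>M)"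
    unfolding set_lebesgue_integral_def real_scaleR_def
  proof (rule nn_integral_eq_integral[symmetric])
    show "integrable M (\<lambda>\<omega>. indicator B \<omega> * real_cond_exp M (past M Xs m) (\<lambda>\<omega>'. indicator A (Xs (Suc m) \<omega>')) \<omega>)"
      using integrable_mult_indicator[OF BM real_cond_exp_int(1)[OF int]] by simp
    \<comment> \<open>The sign is read off from \<open>?c\<close>, a conditional probability that
      agrees almost everywhere.\<close>
    show "AE \<omega> in M. 0 \<le> indicator B \<omega> * real_cond_exp M (past M Xs m) (\<lambda>\<omega>'. indicator A (Xs (Suc m) \<omega>')) \<omega>"
      using c_AE by eventually_elim (simp add: cond_prob_def)
  qed
  also have "\<dots> = (\<integral>\<^sup>+\<omega>. ennreal (?c \<omega>) * indicator B \<omega> \<partial>M)"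
    using c_AE by (intro nn_integral_cong_AE, eventually_elim) (simp add: indicator_def)
  finally show ?thesis unfolding c emeasure_eq_measure .
qed

text \<open>Both sides are additive, homogeneous and continuous along increasing sequences in f, so
  the case of indicators, \<open>sampling_emeasure\<close>, extends to all nonnegative measurable
  f.\<close>

lemma sampling_nn_integral:
  assumes B: "B \<in> sets (past M Xs m)" and f: "f \<in> borel_measurable borel"
  shows "(\<integral>\<^sup>+\<omega>. f (Xs (Suc m) \<omega>) * indicator B \<omega> \<partial>M)
    = (\<integral>\<^sup>+\<omega>. (\<integral>\<^sup>+x. f x * indicator {x. level g Xs m \<omega> < ereal (g x)} x \<partial>\<mu>)
        * inverse (ennreal (\<mu>.tail (level g Xs m \<omega>))) * indicator B \<omega> \<partial>M)"
proof -
  have BM [measurable]: "B \<in> sets M"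
    using B subalgebra_past by (auto simp: subalgebra_def)
  have inner: "(\<lambda>\<omega>. \<integral>\<^sup>+x. u x * indicator {x. level g Xs m \<omega> < ereal (g x)} x \<partial>\<mu>) \<in> borel_measurable M"
    if [measurable]: "u \<in> borel_measurable borel" for u :: "'x \<Rightarrow> ennreal"
    by measurable
  note [measurable] = inner
  show ?thesis
    using f
  proof (induction f rule: borel_measurable_induct)
    case (cong f h)
    then show ?case by simp
  next
    case (set A)
    then have [measurable]: "A \<in> sets borel" .
    have inner_set: "emeasure \<mu> {x \<in> A. level g Xs m \<omega> < ereal (g x)}
        = (\<integral>\<^sup>+x. indicator A x * indicator {x. level g Xs m \<omega> < ereal (g x)} x \<partial>\<mu>)" for \<omega>
      by (subst nn_integral_indicator[symmetric], measurable) (intro nn_integral_cong, simp add: indicator_def)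
    have "(\<integral>\<^sup>+\<omega>. indicator A (Xs (Suc m) \<omega>) * indicator B \<omega> \<partial>M)
        = (\<integral>\<^sup>+\<omega>. indicator {\<omega> \<in> B. Xs (Suc m) \<omega> \<in> A} \<omega> \<partial>M)"
      by (intro nn_integral_cong) (auto simp: indicator_def)
    also have "\<dots> = emeasure M {\<omega> \<in> B. Xs (Suc m) \<omega> \<in> A}"
      by (rule nn_integral_indicator) (rule sampling_event[OF BM \<open>A \<in> sets borel\<close>])
    also note sampling_emeasure[OF B \<open>A \<in> sets borel\<close>]
    finally show ?case unfolding inner_set .
  next
    case (mult u c)
    have [measurable]: "u \<in> borel_measurable borel" by fact
    show ?case
      by (simp add: mult.assoc nn_integral_cmult mult.IH)
  next
    case (add u v)
    have [measurable]: "u \<in> borel_measurable borel" "v \<in> borel_measurable borel" by fact+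
    show ?case
      by (simp add: distrib_right nn_integral_add add.IH)
  next
    case (seq U)
    have [measurable]: "U i \<in> borel_measurable borel" for i by fact
    let ?I = "\<lambda>\<omega>. {x. level g Xs m \<omega> < ereal (g x)}"
    let ?t = "\<lambda>\<omega>. inverse (ennreal (\<mu>.tail (level g Xs m \<omega>)))"
    have mono: "U i x \<le> U j x" if "i \<le> j" for i j x
      using \<open>incseq U\<close> that by (auto simp: incseq_def le_fun_def)
    \<comment> \<open>The right-hand side needs monotone convergence twice: here for the inner
      integral, below for the outer one.\<close>
    have inner_SUP: "(SUP i. (\<integral>\<^sup>+x. U i x * indicator (?I \<omega>) x \<partial>\<mu>))
        = (\<integral>\<^sup>+x. (SUP i. U i) x * indicator (?I \<omega>) x \<partial>\<mu>)" for \<omega>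
    proof -
      have "(SUP i. (\<integral>\<^sup>+x. U i x * indicator (?I \<omega>) x \<partial>\<mu>))
          = (\<integral>\<^sup>+x. (SUP i. U i x * indicator (?I \<omega>) x) \<partial>\<mu>)"
        by (intro nn_integral_monotone_convergence_SUP[symmetric])
          (auto simp: incseq_def le_fun_def intro!: mult_right_mono mono)
      then show ?thesis
        by (simp add: SUP_mult_right_ennreal image_comp)
    qed
    have "(\<integral>\<^sup>+\<omega>. (SUP i. U i) (Xs (Suc m) \<omega>) * indicator B \<omega> \<partial>M)
        = (\<integral>\<^sup>+\<omega>. (SUP i. U i (Xs (Suc m) \<omega>) * indicator B \<omega>) \<partial>M)"
      by (simp add: SUP_mult_right_ennreal image_comp)
    also have "\<dots> = (SUP i. \<integral>\<^sup>+\<omega>. U i (Xs (Suc m) \<omega>) * indicator B \<omega> \<partial>M)"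
      by (intro nn_integral_monotone_convergence_SUP)
        (auto simp: incseq_def le_fun_def intro!: mult_right_mono mono)
    also have "\<dots> = (SUP i. \<integral>\<^sup>+\<omega>. (\<integral>\<^sup>+x. U i x * indicator (?I \<omega>) x \<partial>\<mu>) * ?t \<omega> * indicator B \<omega> \<partial>M)"
      by (simp add: seq.IH)
    also have "\<dots> = (\<integral>\<^sup>+\<omega>. (SUP i. (\<integral>\<^sup>+x. U i x * indicator (?I \<omega>) x \<partial>\<mu>) * ?t \<omega> * indicator B \<omega>) \<partial>M)"
      by (intro nn_integral_monotone_convergence_SUP[symmetric])
        (auto simp: incseq_def le_fun_def intro!: mult_right_mono nn_integral_mono mono)
    also have "\<dots> = (\<integral>\<^sup>+\<omega>. (SUP i. (\<integral>\<^sup>+x. U i x * indicator (?I \<omega>) x \<partial>\<mu>)) * ?t \<omega> * indicator B \<omega> \<partial>M)"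
      by (simp add: SUP_mult_right_ennreal)
    finally show ?case unfolding inner_SUP .
  qed
qed

section \<open>Recursion over the moves that stay at or below q\<close>

text \<open>The event that at least k moves are needed; for k = 0 it is the whole space.\<close>

definition below :: "real \<Rightarrow> nat \<Rightarrow> 'a set" where
  "below q k = {\<omega> \<in> space M. \<forall>i\<in>{1..k}. g (Xs i \<omega>) \<le> q}"

lemma below_in_past: "below q k \<in> sets (past M Xs k)"
proof -
  let ?G = "{Xs i -` A \<inter> space M | i A. i \<in> {1..k} \<and> A \<in> sets borel}"
  have G: "?G \<subseteq> Pow (space M)" by auto
  have space: "space (past M Xs k) = space M"
    using subalgebra_past by (simp add: subalgebra_def)
  have "{\<omega> \<in> space (past M Xs k). \<forall>i\<in>{1..k}. g (Xs i \<omega>) \<le> q} \<in> sets (past M Xs k)"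
  proof (rule sets.sets_Collect_finite_All)
    fix i assume i: "i \<in> {1..k}"
    have "{\<omega> \<in> space M. g (Xs i \<omega>) \<le> q} = Xs i -` {x. g x \<le> q} \<inter> space M" by auto
    moreover have "{x. g x \<le> q} \<in> sets borel" by simp
    ultimately have *: "{\<omega> \<in> space M. g (Xs i \<omega>) \<le> q} \<in> ?G" using i by blast
    have "{\<omega> \<in> space M. g (Xs i \<omega>) \<le> q} \<in> sets (past M Xs k)"
      unfolding past_def sets_measure_of[OF G] by (rule sigma_sets.Basic[OF *])
    then show "{\<omega> \<in> space (past M Xs k). g (Xs i \<omega>) \<le> q} \<in> sets (past M Xs k)"
      unfolding space .
  qed auto
  then show ?thesis by (simp add: below_def space)
qed

lemma below_measurable [measurable]: "below q k \<in> sets M"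
  using below_in_past[of q k] subalgebra_past[of k] by (auto simp: subalgebra_def)

lemma level_le_of_below: "\<omega> \<in> below q k \<Longrightarrow> level g Xs k \<omega> \<le> ereal q"
  by (cases k) (auto simp: below_def)

lemma below_Suc: "\<omega> \<in> below q (Suc k) \<longleftrightarrow> \<omega> \<in> below q k \<and> g (Xs (Suc k) \<omega>) \<le> q"
  by (auto simp: below_def atLeastAtMostSuc_conv)

text \<open>Conditioning the newest position on the past and substituting its tail leaves an
  integral of the weight over [p, s], where p = \<open>\<mu>.tail q\<close> and s is the tail of the
  k-th level. Division by s yields the next weight at s.\<close>

lemma log_weight_step:
  assumes p: "0 < \<mu>.tail q"
  shows "(\<integral>\<^sup>+\<omega>. ennreal (log_weight (\<mu>.tail q) j (\<mu>.tail (level g Xs (Suc k) \<omega>))) * indicator (below q (Suc k)) \<omega> \<partial>M)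
    = (\<integral>\<^sup>+\<omega>. ennreal (log_weight (\<mu>.tail q) (Suc j) (\<mu>.tail (level g Xs k \<omega>))) * indicator (below q k) \<omega> \<partial>M)"
proof -
  let ?w = "log_weight (\<mu>.tail q)" and ?l = "level g Xs k"
  \<comment> \<open>The constraint on the newest position goes into the integrand, so that the
    remaining event \<open>below q k\<close> lies in the past.\<close>
  let ?f = "\<lambda>x. ennreal (?w j (\<mu>.tail (g x))) * indicator {x. g x \<le> q} x"
  have "(\<integral>\<^sup>+\<omega>. ennreal (?w j (\<mu>.tail (level g Xs (Suc k) \<omega>))) * indicator (below q (Suc k)) \<omega> \<partial>M)
      = (\<integral>\<^sup>+\<omega>. ?f (Xs (Suc k) \<omega>) * indicator (below q k) \<omega> \<partial>M)"
    by (intro nn_integral_cong) (auto simp: below_Suc split: split_indicator)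
  also have "\<dots> = (\<integral>\<^sup>+\<omega>. (\<integral>\<^sup>+x. ?f x * indicator {x. ?l \<omega> < ereal (g x)} x \<partial>\<mu>)
      * inverse (ennreal (\<mu>.tail (?l \<omega>))) * indicator (below q k) \<omega> \<partial>M)"
    by (intro sampling_nn_integral below_in_past) measurable
  also have "\<dots> = (\<integral>\<^sup>+\<omega>. ennreal (?w (Suc j) (\<mu>.tail (?l \<omega>))) * indicator (below q k) \<omega> \<partial>M)"
  proof (intro nn_integral_cong)
    fix \<omega>
    have "(\<integral>\<^sup>+x. ?f x * indicator {x. ?l \<omega> < ereal (g x)} x \<partial>\<mu>) * inverse (ennreal (\<mu>.tail (?l \<omega>)))
        = ennreal (?w (Suc j) (\<mu>.tail (?l \<omega>)))" if "\<omega> \<in> below q k"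
    proof -
      have s: "\<mu>.tail q \<le> \<mu>.tail (?l \<omega>)"
        by (rule \<mu>.tail_antimono[OF level_le_of_below[OF that]])
      have "(\<integral>\<^sup>+x. ?f x * indicator {x. ?l \<omega> < ereal (g x)} x \<partial>\<mu>)
          = (\<integral>\<^sup>+x. ennreal (?w j (\<mu>.tail (g x))) * indicator {x. ?l \<omega> < ereal (g x) \<and> g x \<le> q} x \<partial>\<mu>)"
        by (intro nn_integral_cong) (auto split: split_indicator)
      also have "\<dots> = (\<integral>\<^sup>+u. ennreal (?w j u) * indicator {\<mu>.tail q..\<mu>.tail (?l \<omega>)} u \<partial>lborel)"
        by (rule \<mu>.nn_integral_tail_score) measurable
      also have "\<dots> = ennreal (\<mu>.tail (?l \<omega>) * ?w (Suc j) (\<mu>.tail (?l \<omega>)))"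
        by (rule nn_integral_log_weight[OF p s])
      finally show ?thesis
        using p s log_weight_nonneg[OF p s, of "Suc j"]
        by (simp add: divide_ennreal flip: divide_ennreal_def)
    qed
    then show "(\<integral>\<^sup>+x. ?f x * indicator {x. ?l \<omega> < ereal (g x)} x \<partial>\<mu>)
        * inverse (ennreal (\<mu>.tail (?l \<omega>))) * indicator (below q k) \<omega>
        = ennreal (?w (Suc j) (\<mu>.tail (?l \<omega>))) * indicator (below q k) \<omega>"
      by (simp split: split_indicator)
  qed
  finally show ?thesis .
qed

text \<open>Each step trades one position for one unit of j, so j is arbitrary in the induction. At
  k = 0 the level is minus infinity, whose tail is 1.\<close>

lemma nn_integral_log_weight_below:
  assumes p: "0 < \<mu>.tail q"
  shows "(\<integral>\<^sup>+\<omega>. ennreal (log_weight (\<mu>.tail q) j (\<mu>.tail (level g Xs k \<omega>))) * indicator (below q k) \<omega> \<partial>M)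
    = ennreal (log_weight (\<mu>.tail q) (j + k) 1)"
proof (induction k arbitrary: j)
  case 0
  have "(\<integral>\<^sup>+\<omega>. ennreal (log_weight (\<mu>.tail q) j (\<mu>.tail (level g Xs 0 \<omega>))) * indicator (below q 0) \<omega> \<partial>M)
      = (\<integral>\<^sup>+\<omega>. ennreal (log_weight (\<mu>.tail q) j 1) \<partial>M)"
    by (intro nn_integral_cong) (simp add: below_def \<mu>.tail_MInfty)
  then show ?case by (simp add: emeasure_space_1)
next
  case (Suc k)
  then show ?case by (simp add: log_weight_step[OF p] del: level.simps)
qed

section \<open>The law of the number of moves\<close>

text \<open>Separates what the first k positions decide from the condition on the next one, as
  \<open>sampling_emeasure\<close> requires.\<close>

lemma number_of_moves_event:
  "{\<omega> \<in> space M. number_of_moves g Xs q \<omega> = enat k} = {\<omega> \<in> below q k. Xs (Suc k) \<omega> \<in> {x. q < g x}}"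
  by (auto simp: number_of_moves_eq_enat_iff below_def)

lemma number_of_moves_measurable [measurable]:
  "number_of_moves g Xs q \<in> measurable M (count_space UNIV)"
proof -
  have fin: "{\<omega> \<in> space M. number_of_moves g Xs q \<omega> = enat k} \<in> sets M" for k
    unfolding number_of_moves_event by (rule sampling_event) auto
  have "{\<omega> \<in> space M. number_of_moves g Xs q \<omega> = \<infinity>}
      = space M - (\<Union>k. {\<omega> \<in> space M. number_of_moves g Xs q \<omega> = enat k})"
    by auto
  with fin have inf: "{\<omega> \<in> space M. number_of_moves g Xs q \<omega> = \<infinity>} \<in> sets M" by auto
  have "number_of_moves g Xs q -` {n} \<inter> space M \<in> sets M" for n
    using fin inf by (cases n) (auto simp: vimage_def Int_def conj_commute)
  then show ?thesis by (simp add: measurable_count_space_eq_countable)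
qed

lemma emeasure_number_of_moves:
  assumes p: "0 < \<mu>.tail q"
  shows "emeasure M {\<omega> \<in> space M. number_of_moves g Xs q \<omega> = enat k}
    = ennreal (pmf (poisson_law (ln (1 / \<mu>.tail q))) k)"
proof -
  let ?l = "level g Xs k"
  have "emeasure M {\<omega> \<in> space M. number_of_moves g Xs q \<omega> = enat k}
      = (\<integral>\<^sup>+\<omega>. emeasure \<mu> {x \<in> {x. q < g x}. ?l \<omega> < ereal (g x)} * inverse (ennreal (\<mu>.tail (?l \<omega>)))
        * indicator (below q k) \<omega> \<partial>M)"
    unfolding number_of_moves_event by (intro sampling_emeasure below_in_past) simp
  also have "\<dots> = (\<integral>\<^sup>+\<omega>. ennreal (log_weight (\<mu>.tail q) 0 (\<mu>.tail (?l \<omega>))) * indicator (below q k) \<omega> \<partial>M)"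
  proof (intro nn_integral_cong)
    fix \<omega>
    have "emeasure \<mu> {x \<in> {x. q < g x}. ?l \<omega> < ereal (g x)} * inverse (ennreal (\<mu>.tail (?l \<omega>)))
        = ennreal (log_weight (\<mu>.tail q) 0 (\<mu>.tail (?l \<omega>)))" if "\<omega> \<in> below q k"
    proof -
      \<comment> \<open>As the level is at most q, exceeding q implies exceeding the level. The
        chance of jumping into F is therefore a quotient of tails, which is the weight with j =
        0.\<close>
      have l: "?l \<omega> \<le> ereal q" by (rule level_le_of_below[OF that])
      then have "{x \<in> {x. q < g x}. ?l \<omega> < ereal (g x)} = {x. ereal q < ereal (g x)}"
        by (auto intro: order.strict_trans1)
      then show ?thesis
        using p \<mu>.tail_antimono[OF l]
        by (simp add: \<mu>.emeasure_eq_measure log_weight_def \<mu>.tail_def divide_ennreal flip: divide_ennreal_def)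
    qed
    then show "emeasure \<mu> {x \<in> {x. q < g x}. ?l \<omega> < ereal (g x)} * inverse (ennreal (\<mu>.tail (?l \<omega>)))
        * indicator (below q k) \<omega>
        = ennreal (log_weight (\<mu>.tail q) 0 (\<mu>.tail (?l \<omega>))) * indicator (below q k) \<omega>"
      by (simp split: split_indicator)
  qed
  also have "\<dots> = ennreal (log_weight (\<mu>.tail q) k 1)"
    using nn_integral_log_weight_below[OF p, of 0 k] by simp
  \<comment> \<open>The rate is nonnegative because the tail is at most 1; a tail equal to 1 gives
    rate 0, which \<open>poisson_law\<close> covers.\<close>
  also have "log_weight (\<mu>.tail q) k 1 = pmf (poisson_law (ln (1 / \<mu>.tail q))) k"
    using p \<mu>.tail_le_1[of q] by (subst pmf_poisson_law) (simp_all add: log_weight_def ln_div)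
  finally show ?thesis .
qed

text \<open>The masses at finite values agree and the Poisson masses already sum to 1. No mass is
  left for infinity, so q is almost surely exceeded.\<close>

lemma distr_number_of_moves:
  assumes p: "0 < \<mu>.tail q"
  shows "distr M (count_space UNIV) (number_of_moves g Xs q)
    = measure_pmf (map_pmf enat (poisson_law (ln (1 / \<mu>.tail q))))" (is "?D = measure_pmf ?P")
proof -
  interpret D: prob_space ?D by (rule prob_space_distr) simp
  have eq: "emeasure ?D {enat k} = emeasure (measure_pmf ?P) {enat k}" for k
  proof -
    have "emeasure ?D {enat k} = emeasure M {\<omega> \<in> space M. number_of_moves g Xs q \<omega> = enat k}"
      by (subst emeasure_distr) (auto intro!: arg_cong[where f = "emeasure M"])
    then show ?thesis
      by (simp add: emeasure_number_of_moves[OF p] emeasure_pmf_single pmf_map_inj' inj_def)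
  qed
  have range: "emeasure N (range enat) = (\<Sum>k. emeasure N {enat k})"
    if "sets N = UNIV" for N :: "enat measure"
  proof -
    have "emeasure N (range enat) = emeasure N (\<Union>k. {enat k})"
      by (rule arg_cong[where f = "emeasure N"]) auto
    also have "\<dots> = (\<Sum>k. emeasure N {enat k})"
      using that by (intro suminf_emeasure[symmetric]) (auto simp: disjoint_family_on_def)
    finally show ?thesis .
  qed
  have AE_P: "AE n in measure_pmf ?P. n \<in> range enat"
    by (auto simp: AE_measure_pmf_iff)
  then have "emeasure (measure_pmf ?P) (range enat) = 1"
    by (intro measure_pmf.emeasure_eq_1_AE) auto
  moreover have "emeasure ?D (range enat) = emeasure (measure_pmf ?P) (range enat)"
    by (subst (1 2) range) (simp_all only: eq sets_distr sets_count_space Pow_UNIV sets_measure_pmf)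
  ultimately have "D.prob (range enat) = 1" by (simp add: measure_def)
  then have AE_D: "AE n in ?D. n \<in> range enat"
    by (rule D.AE_prob_1)
  show ?thesis
    by (rule measure_eqI_countable_AE[OF _ _ AE_D AE_P]) (auto simp: eq)
qed

end

theorem corollary1:
  fixes N :: "'b measure"
    and X :: "'b \<Rightarrow> real ^ 'd"
    and \<mu> :: "(real ^ 'd) measure"
    and g :: "real ^ 'd \<Rightarrow> real"
    and q p :: real
    and F :: "(real ^ 'd) set"
    and M :: "'a measure"
    and Xs :: "nat \<Rightarrow> 'a \<Rightarrow> real ^ 'd"
  assumes "prob_space N"
    and "X \<in> measurable N borel"
    and "\<mu> = distr N borel X"
    and "g \<in> borel_measurable borel"
    and "continuous_on UNIV (cdf (distr N borel (\<lambda>\<omega>. g (X \<omega>))))"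
    and "F = {x. g x > q}"
    and "p = measure \<mu> F"
    and "p > 0"
    and "one_particle_process M \<mu> g Xs"
  shows "number_of_moves g Xs q \<in> measurable M (count_space UNIV)
    \<and> distr M (count_space UNIV) (number_of_moves g Xs q)
      = measure_pmf (map_pmf enat (poisson_law (ln (1 / p))))"
proof -
  interpret N: prob_space N by fact
  interpret \<mu>: prob_space \<mu>
    unfolding assms(3) using assms(2) by (rule N.prob_space_distr)
  \<comment> \<open>Moves the continuity assumption from g(X) under N to g under the law \<mu> of
    X.\<close>
  have "distr \<mu> borel g = distr N borel (\<lambda>\<omega>. g (X \<omega>))"
    unfolding assms(3) using assms(2,4) by (subst distr_distr) (auto simp: comp_def)
  then interpret \<mu>: continuous_score \<mu> g
    using assms by unfold_locales auto
  interpret one_particle_process M \<mu> g Xs by fact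
  interpret continuous_one_particle_process M \<mu> g Xs ..
  have "\<mu>.tail q = p"
    unfolding \<mu>.tail_def assms(6,7) by simp
  then show ?thesis
    using number_of_moves_measurable[of q] distr_number_of_moves[of q] assms by simp
qed

end
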